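(* Let $s$ be a positive integer and suppose that a nonempty $s$-uniform hypergraph $\mathcal{H}$ and reals $p, \delta \in (0,1)$ satisfy \[ 300 s^4 \cdot \sum_{t=1}^s \binom{s-1}{t-1} \left(\frac{5000 s^3}{p}\right)^{t-1} \| \sigma_{\mathcal{H}}^{(t)} \|^2 \leq \frac{1}{\delta \cdot v(\mathcal{H})} \leq \frac{p}{500}. \] Then there exist a family $\mathcal{S}$ of subsets of $V(\mathcal{H})$, each of cardinality at most $30 s^2 p \cdot v(\mathcal{H})$, and functions $f \colon \mathcal{S} \to \mathcal{P}(V(\mathcal{H}))$ and $g \colon \mathcal{I}(\mathcal{H}) \to \mathcal{S}$ such that, for every $I \in \mathcal{I}(\mathcal{H})$, \[ g(I) \subseteq I \subseteq g(I) \cup f(g(I)) \qquad \text{and} \qquad |f(g(I))| \leq (1-\delta) \cdot v(\mathcal{H}). \] Moreover, if $g(I) \subseteq I'$ and $g(I') \subseteq I$ for some $I, I' \in \mathcal{I}(\mathcal{H})$, then $g(I) = g(I')$.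
   Context: All hypergraphs are finite. A hypergraph is $s$-uniform if each of its edges is a set of exactly $s$ vertices; edges may have positive integer multiplicities, and edges are always counted with multiplicity. $v(\mathcal{H})$ and $e(\mathcal{H})$ are the numbers of vertices and edges of $\mathcal{H}$; $\mathcal{H}$ is nonempty if it has at least one edge. For $T \subseteq V(\mathcal{H})$, $\deg_{\mathcal{H}} T$ is the number of edges of $\mathcal{H}$ containing $T$. For a nonempty $s$-uniform hypergraph $\mathcal{H}$ with vertex set $V$ and $t \in \{1,\dotsc,s\}$, the $t$-degree measure $\sigma_{\mathcal{H}}^{(t)}$ is the probability distribution on the family $\binom{V}{t}$ of $t$-element subsets of $V$ given by \[ \sigma_{\mathcal{H}}^{(t)}(T) = \frac{\deg_{\mathcal{H}} T}{\binom{s}{t} \cdot e(\mathcal{H})}, \] viewed as a vector in $\mathbb{R}^{\binom{V}{t}}$; $\|\cdot\|$ is the $\ell^2$-norm, so $\|\sigma_{\mathcal{H}}^{(t)}\|^2 = \sum_{T} \sigma_{\mathcal{H}}^{(t)}(T)^2$. $\mathcal{I}(\mathcal{H})$ is the family of independent sets of $\mathcal{H}$ (subsets of $V(\mathcal{H})$ containing no edge). $\mathcal{P}(X)$ is the power set of $X$. *)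

theory Defs
  imports "HOL-Analysis.L2_Norm" "HOL-Library.Multiset" "HOL-Library.FuncSet"
begin

text \<open>
  A hypergraph is given by its vertex set \<open>V\<close> and its multiset \<open>E\<close> of edges, so that the number of
  vertices is \<open>card V\<close> and the number of edges, counted with multiplicity, is \<open>size E\<close>.
\<close>

locale hypergraph =
  fixes V :: "'a set" and E :: "'a set multiset"
  assumes finite_vertices: "finite V"
    and edge_subset: "\<And>e. e \<in># E \<Longrightarrow> e \<subseteq> V"

locale uniform_hypergraph = hypergraph V E
  for s :: nat and V :: "'a set" and E :: "'a set multiset" +
  assumes card_edge: "\<And>e. e \<in># E \<Longrightarrow> card e = s"

definition hdegree :: "'a set multiset \<Rightarrow> 'a set \<Rightarrow> nat" where
  "hdegree E T = size {#e \<in># E. T \<subseteq> e#}"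

definition degree_measure :: "nat \<Rightarrow> 'a set multiset \<Rightarrow> nat \<Rightarrow> 'a set \<Rightarrow> real" where
  "degree_measure s E t T = real (hdegree E T) / (real (s choose t) * real (size E))"

definition degree_measure_norm :: "nat \<Rightarrow> 'a set \<Rightarrow> 'a set multiset \<Rightarrow> nat \<Rightarrow> real" where
  "degree_measure_norm s V E t = L2_set (degree_measure s E t) {T. T \<subseteq> V \<and> card T = t}"

definition independent_sets :: "'a set \<Rightarrow> 'a set multiset \<Rightarrow> 'a set set" where
  "independent_sets V E = {I. I \<subseteq> V \<and> (\<forall>e \<in># E. \<not> e \<subseteq> I)}"

lemma degree_measure_nonneg: "degree_measure s E t T \<ge> 0"
  by (simp add: degree_measure_def)

lemma (in uniform_hypergraph) sum_degree_measure:
  assumes "E \<noteq> {#}" and "t \<le> s"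
  shows "(\<Sum>T | T \<subseteq> V \<and> card T = t. degree_measure s E t T) = 1"
proof -
  let ?A = "{T. T \<subseteq> V \<and> card T = t}"
  have fin: "finite ?A"
    using finite_vertices by simp
  have "(\<Sum>T\<in>?A. hdegree F T) = (s choose t) * size F"
    if "\<And>e. e \<in># F \<Longrightarrow> e \<subseteq> V \<and> card e = s" for F
    using that
  proof (induction F)
    case empty
    then show ?case by (simp add: hdegree_def)
  next
    case (add e F)
    have e: "e \<subseteq> V" "card e = s" using add.prems by auto
    have "finite e" using e(1) finite_vertices finite_subset by blast
    have "(\<Sum>T\<in>?A. hdegree (add_mset e F) T)
        = (\<Sum>T\<in>?A. hdegree F T + (if T \<subseteq> e then 1 else 0))"
      by (intro sum.cong) (auto simp: hdegree_def)
    also have "\<dots> = (\<Sum>T\<in>?A. hdegree F T) + card {T \<in> ?A. T \<subseteq> e}"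
      using fin by (simp add: sum.distrib sum.If_cases Int_def)
    also have "{T \<in> ?A. T \<subseteq> e} = {T. T \<subseteq> e \<and> card T = t}"
      using e by auto
    also have "card \<dots> = s choose t"
      using n_subsets[OF \<open>finite e\<close>] e by simp
    also have "(\<Sum>T\<in>?A. hdegree F T) = (s choose t) * size F"
      using add by auto
    finally show ?case by simp
  qed
  then have "(\<Sum>T\<in>?A. hdegree E T) = (s choose t) * size E"
    using edge_subset card_edge by blast
  then have "(\<Sum>T\<in>?A. real (hdegree E T)) = real (s choose t) * real (size E)"
    by (metis of_nat_sum of_nat_mult)
  moreover have "real (s choose t) * real (size E) \<noteq> 0"
    using assms by simp
  ultimately show ?thesis
    unfolding degree_measure_def sum_divide_distrib[symmetric] by simp
qed

end

theory Submission
  imports Defs "HOL-Analysis.Convex"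
begin

text \<open>
  The fingerprint and the container of an independent set \<open>I\<close> come from a strategy that asks
  adaptively chosen questions ``is \<open>v\<close> in \<open>I\<close>?''. The fingerprint collects the vertices that received
  the answer yes; since the answers determine the further course of the questioning, the fingerprint
  determines the whole run, and with it the container (lemma \<open>same_run\<close>). It remains to find a strategy
  that needs few positive answers and ends with the exclusion of at least \<open>\<delta> * card V\<close> vertices.

  The strategy works in rounds that lower the uniformity by one. A round starts from a weight \<open>w\<close> on
  \<open>(k + 1)\<close>-sets, of total mass 1, none of whose edges lies inside \<open>I\<close>. Every vertex \<open>v\<close> of \<open>I\<close> that is
  found yields the normalised link of \<open>v\<close> in \<open>w\<close>, which is a weight on \<open>k\<close>-sets with the same
  property, and the average of the links found in the round is the weight for the next round. When
  the uniformity is 1, every vertex of positive weight is excluded from \<open>I\<close>, and by the Cauchy--Schwarz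
  inequality there are at least \<open>1 / energy\<close> of them, where the energy of a weight is the weighted sum of
  the \<open>\<parallel>\<sigma>\<^sup>t\<parallel>\<^sup>2\<close> that appears in the hypothesis. So everything rests on the energy growing by a factor of
  only \<open>1 + O(1 / s)\<close> in each round, hence by a constant factor in total.

  The energy is a positive semidefinite quadratic form. If \<open>v\<close> is random with the distribution
  \<open>\<sigma>\<^sup>1\<close>, then the expected link has degree measures equal to those of \<open>w\<close>, so its energy is at
  most that of \<open>w\<close> (lemma \<open>mean_pairing_link\<close> is the bilinear form of this). The expected energy of a
  single link is at most of order \<open>s * card V / B\<close> times that of \<open>w\<close>, provided that vertices of very
  small degree are disregarded (lemma \<open>mean_energy_link\<close>). As long as fewer than \<open>\<delta> * card V\<close> answers
  were negative, Cauchy--Schwarz and the smallness of the energy show that the vertices still available carry almost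
  all of \<open>\<sigma>\<^sup>1\<close> (lemma \<open>mass_of_good_vertices\<close>), so some available vertex is at least
  about as good as the average one when its link is added to the sum of the links found so far
  (lemma \<open>exists_good_link\<close>). Asking for such a vertex each time keeps the energy of the sum of \<open>j\<close> links
  close to \<open>j\<^sup>2\<close> times the energy of \<open>w\<close>: the variance contributes only a term that is negligible once
  \<open>j\<close> reaches \<open>p * card V\<close>.
\<close>

section \<open>Query trees\<close>

datatype 'a query_tree = Leaf "'a set" | Query 'a "'a query_tree" "'a query_tree"

fun fingerprint :: "'a query_tree \<Rightarrow> 'a set \<Rightarrow> 'a set" where
  "fingerprint (Leaf C) I = {}"
| "fingerprint (Query v yes no) I =
     (if v \<in> I then insert v (fingerprint yes I) else fingerprint no I)"

fun container :: "'a query_tree \<Rightarrow> 'a set \<Rightarrow> 'a set" where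
  "container (Leaf C) I = C"
| "container (Query v yes no) I = (if v \<in> I then container yes I else container no I)"

lemma fingerprint_subset: "fingerprint t I \<subseteq> I"
  by (induction t) auto

lemma finite_fingerprint: "finite (fingerprint t I)"
  by (induction t) auto

text \<open>
  Consider the first query at which the runs on \<open>I\<close> and \<open>J\<close> get different answers. Its vertex lies in
  the fingerprint of one of the two sets but not in the other set, contrary to the assumption. This
  gives both the last claim of the container theorem and, with \<open>J\<close> a fingerprint, the
  fact that the container is a function of the fingerprint.
\<close>

lemma same_run:
  assumes "fingerprint t I \<subseteq> J" and "fingerprint t J \<subseteq> I"
  shows "fingerprint t I = fingerprint t J \<and> container t I = container t J"
  using assms by (induction t) (auto split: if_splits)

text \<open>
  The existence of a winning strategy when \<open>I\<close> is known to belong to \<open>F\<close>, \<open>b\<close> positive answers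
  may still be received, and the admissible containers are those that satisfy \<open>P\<close>. Strategies are built
  through this predicate, so that query trees need not be written down.
\<close>

definition coverable :: "('a set \<Rightarrow> bool) \<Rightarrow> 'a set set \<Rightarrow> nat \<Rightarrow> bool" where
  "coverable P F b \<longleftrightarrow> (\<exists>t. \<forall>I\<in>F. I \<subseteq> container t I \<and> P (container t I) \<and> card (fingerprint t I) \<le> b)"

lemma coverable_leaf:
  assumes "P C" and "\<And>I. I \<in> F \<Longrightarrow> I \<subseteq> C"
  shows "coverable P F b"
  unfolding coverable_def using assms by (intro exI[of _ "Leaf C"]) auto

lemma coverable_mono:
  assumes "coverable P F b" and "F' \<subseteq> F" and "b \<le> b'"
  shows "coverable P F' b'"
  using assms unfolding coverable_def by (meson le_trans subsetD)

lemma coverable_query: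
  assumes "coverable P {I \<in> F. v \<in> I} b" and "coverable P {I \<in> F. v \<notin> I} (Suc b)"
  shows "coverable P F (Suc b)"
proof -
  obtain y where y: "\<And>I. I \<in> F \<Longrightarrow> v \<in> I \<Longrightarrow>
      I \<subseteq> container y I \<and> P (container y I) \<and> card (fingerprint y I) \<le> b"
    using assms(1) unfolding coverable_def by blast
  obtain n where n: "\<And>I. I \<in> F \<Longrightarrow> v \<notin> I \<Longrightarrow>
      I \<subseteq> container n I \<and> P (container n I) \<and> card (fingerprint n I) \<le> Suc b"
    using assms(2) unfolding coverable_def by blast
  have "card (insert v (fingerprint y I)) \<le> Suc b" if "I \<in> F" "v \<in> I" for I
    using y[OF that] finite_fingerprint[of y I] by (simp add: card_insert_if)
  then show ?thesis
    unfolding coverable_def using y n by (intro exI[of _ "Query v y n"]) auto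
qed

definition avoids :: "('a set \<Rightarrow> real) \<Rightarrow> 'a set \<Rightarrow> bool" where
  "avoids w I \<longleftrightarrow> (\<forall>e. e \<subseteq> I \<longrightarrow> w e = 0)"

text \<open>
  One round of the strategy, stripped of everything quantitative. The pair \<open>j\<close>, \<open>z\<close> is the number of
  positive answers and the weight accumulated from them; \<open>N\<close> is the set of vertices with a negative
  answer. The game ends because each answer increases \<open>j\<close> or enlarges \<open>N\<close>. A vertex that is already
  known to lie in \<open>I\<close> may be selected again.
\<close>

lemma coverable_by_selection:
  fixes V :: "'a set" and d :: real
  assumes "finite V"
    and many_no: "\<And>N. N \<subseteq> V \<Longrightarrow> d \<le> real (card N) \<Longrightarrow> P (V - N)"
    and select: "\<And>j z N. j < m \<Longrightarrow> reach j z \<Longrightarrow> N \<subseteq> V \<Longrightarrow> real (card N) < d \<Longrightarrow>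
        \<exists>v\<in>V - N. \<exists>z'. reach (Suc j) z' \<and> (\<forall>I\<in>F. v \<in> I \<longrightarrow> avoids z I \<longrightarrow> avoids z' I)"
    and finish: "\<And>z. reach m z \<Longrightarrow> coverable P {I. I \<subseteq> V \<and> avoids z I} b"
    and F: "F \<subseteq> Pow V"
  shows "j \<le> m \<Longrightarrow> reach j z \<Longrightarrow> N \<subseteq> V \<Longrightarrow>
    coverable P {I \<in> F. avoids z I \<and> I \<inter> N = {}} (b + (m - j))"
proof (induction "(m - j) + card (V - N)" arbitrary: j z N rule: less_induct)
  case less
  show ?case
  proof (cases "d \<le> real (card N)")
    case True
    show ?thesis
      using many_no[OF less.prems(3) True] F by (intro coverable_leaf[where C = "V - N"]) auto
  next
    case few: False
    show ?thesis
    proof (cases "j = m")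
      case True
      show ?thesis
        by (rule coverable_mono[OF finish]) (use less.prems True F in auto)
    next
      case False
      then have j: "j < m" using less.prems by simp
      obtain v z' where v: "v \<in> V - N" and z': "reach (Suc j) z'"
        and imp: "\<And>I. I \<in> F \<Longrightarrow> v \<in> I \<Longrightarrow> avoids z I \<Longrightarrow> avoids z' I"
        using select[OF j less.prems(2,3)] few by fastforce
      have "coverable P {I \<in> F. avoids z' I \<and> I \<inter> N = {}} (b + (m - Suc j))"
        by (rule less.hyps) (use j z' less.prems in auto)
      then have yes: "coverable P {I \<in> {I \<in> F. avoids z I \<and> I \<inter> N = {}}. v \<in> I} (b + (m - Suc j))"
        by (rule coverable_mono) (use imp in auto)
      have "V - insert v N \<subset> V - N" using v by auto
      then have "card (V - insert v N) < card (V - N)"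
        using \<open>finite V\<close> by (simp add: psubset_card_mono)
      then have "coverable P {I \<in> F. avoids z I \<and> I \<inter> insert v N = {}} (b + (m - j))"
        by (intro less.hyps) (use v less.prems in auto)
      moreover have "b + (m - j) = Suc (b + (m - Suc j))" using j by simp
      ultimately have no: "coverable P {I \<in> {I \<in> F. avoids z I \<and> I \<inter> N = {}}. v \<notin> I}
          (Suc (b + (m - Suc j)))"
        by (auto elim!: coverable_mono)
      show ?thesis
        using coverable_query[OF yes no] \<open>b + (m - j) = _\<close> by simp
    qed
  qed
qed

section \<open>Weighted uniform hypergraphs\<close>

text \<open>
  Hypergraphs are replaced by nonnegative weights on sets, because averages of links
  are then again objects of the same kind. The parameter \<open>B\<close> is the number \<open>5000 * s ^ 3 / p\<close> of the
  theorem, which stays fixed while the uniformity drops.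
\<close>

locale weighted_ground =
  fixes V :: "'a set" and B :: real
  assumes finite_V: "finite V" and B_pos: "0 < B"
begin

definition deg :: "('a set \<Rightarrow> real) \<Rightarrow> 'a set \<Rightarrow> real" where
  "deg w T = (\<Sum>e\<in>Pow V. if T \<subseteq> e then w e else 0)"

definition uniform_weight :: "nat \<Rightarrow> ('a set \<Rightarrow> real) \<Rightarrow> bool" where
  "uniform_weight k w \<longleftrightarrow> (\<forall>e. 0 \<le> w e) \<and> (\<forall>e. w e \<noteq> 0 \<longrightarrow> e \<subseteq> V \<and> card e = k)"

definition link :: "('a set \<Rightarrow> real) \<Rightarrow> 'a \<Rightarrow> 'a set \<Rightarrow> real" where
  "link w v T = (if v \<in> T then 0 else w (insert v T) / deg w {v})"

text \<open>
  Since the degrees are not normalised, the factor of \<open>(deg x T)\<^sup>2\<close> in the energy has to be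
  \<open>((k - 1) choose (t - 1)) * B ^ (t - 1) / (k choose t)\<^sup>2\<close> for \<open>t = card T \<ge> 1\<close>. The expression below equals
  it, because \<open>t * (k choose t) = k * ((k - 1) choose (t - 1))\<close>, and vanishes for \<open>t = 0\<close> and,
  by division by zero, for \<open>t > k\<close>; so the sum can range over all subsets of \<open>V\<close>.
\<close>

definition coeff :: "nat \<Rightarrow> nat \<Rightarrow> real" where
  "coeff k t = real t * B ^ (t - 1) / (real k * real (k choose t))"

definition pairing :: "nat \<Rightarrow> ('a set \<Rightarrow> real) \<Rightarrow> ('a set \<Rightarrow> real) \<Rightarrow> real" where
  "pairing k x y = (\<Sum>T\<in>Pow V. coeff k (card T) * (deg x T * deg y T))"

abbreviation energy :: "nat \<Rightarrow> ('a set \<Rightarrow> real) \<Rightarrow> real" where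
  "energy k x \<equiv> pairing k x x"

lemma coeff_nonneg: "0 \<le> coeff k t"
  unfolding coeff_def using B_pos by simp

lemma uniform_weightD:
  assumes "uniform_weight k w"
  shows "0 \<le> w e" and "w e \<noteq> 0 \<Longrightarrow> e \<subseteq> V" and "w e \<noteq> 0 \<Longrightarrow> card e = k"
  using assms unfolding uniform_weight_def by auto

lemma deg_nonneg: "uniform_weight k w \<Longrightarrow> 0 \<le> deg w T"
  unfolding deg_def by (intro sum_nonneg) (auto dest: uniform_weightD)

lemma deg_mono: "uniform_weight k w \<Longrightarrow> S \<subseteq> T \<Longrightarrow> deg w T \<le> deg w S"
  unfolding deg_def by (intro sum_mono) (auto dest: uniform_weightD)

lemma deg_add: "deg (\<lambda>e. x e + y e) T = deg x T + deg y T"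
  unfolding deg_def sum.distrib[symmetric] by (intro sum.cong) auto

lemma deg_divide: "deg (\<lambda>e. x e / c) T = deg x T / c"
  unfolding deg_def sum_divide_distrib by (intro sum.cong) auto

lemma deg_zero: "deg (\<lambda>e. 0) T = 0"
  unfolding deg_def by simp

text \<open>
  Double counting: an edge of size \<open>k\<close> that contains \<open>T\<close> is counted once for each of its \<open>k - card T\<close>
  vertices outside \<open>T\<close>.
\<close>

lemma sum_deg_insert:
  assumes w: "uniform_weight k w" and T: "T \<subseteq> V"
  shows "(\<Sum>v\<in>V - T. deg w (insert v T)) = (real k - real (card T)) * deg w T"
proof -
  have "(\<Sum>v\<in>V - T. deg w (insert v T))
      = (\<Sum>e\<in>Pow V. \<Sum>v\<in>V - T. if insert v T \<subseteq> e then w e else 0)"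
    unfolding deg_def by (rule sum.swap)
  also have "\<dots> = (\<Sum>e\<in>Pow V. (real k - real (card T)) * (if T \<subseteq> e then w e else 0))"
  proof (rule sum.cong[OF refl])
    fix e assume "e \<in> Pow V"
    then have e: "e \<subseteq> V" by simp
    show "(\<Sum>v\<in>V - T. if insert v T \<subseteq> e then w e else 0)
        = (real k - real (card T)) * (if T \<subseteq> e then w e else 0)"
    proof (cases "T \<subseteq> e \<and> w e \<noteq> 0")
      case True
      have fin: "finite e" "finite T" using e T finite_V by (auto intro: finite_subset)
      have "(\<Sum>v\<in>V - T. if insert v T \<subseteq> e then w e else 0) = (\<Sum>v\<in>V - T. if v \<in> e then w e else 0)"
        using True by (intro sum.cong) auto
      also have "\<dots> = (\<Sum>v\<in>(V - T) \<inter> e. w e)"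
        by (rule sum.inter_restrict[symmetric]) (use finite_V in auto)
      also have "(V - T) \<inter> e = e - T" using e by auto
      also have "(\<Sum>v\<in>e - T. w e) = real (card e - card T) * w e"
        using True fin by (simp add: card_Diff_subset)
      also have "real (card e - card T) = real k - real (card T)"
        using True fin uniform_weightD(3)[OF w] card_mono[of e T] by (simp add: of_nat_diff)
      finally show ?thesis using True by simp
    qed (auto intro!: sum.neutral)
  qed
  also have "\<dots> = (real k - real (card T)) * deg w T"
    unfolding deg_def by (simp add: sum_distrib_left)
  finally show ?thesis .
qed

text \<open>
  Multiplying by the degree of \<open>v\<close> avoids a case distinction: when that degree is 0, so are
  the link and all degrees of sets that contain \<open>v\<close>.
\<close>

lemma deg_link:
  assumes w: "uniform_weight k w" and v: "v \<in> V"
  shows "deg w {v} * deg (link w v) T = (if v \<in> T then 0 else deg w (insert v T))"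
proof (cases "v \<in> T")
  case True
  then have "deg (link w v) T = 0"
    unfolding deg_def link_def by (intro sum.neutral) auto
  with True show ?thesis by simp
next
  case False
  show ?thesis
  proof (cases "deg w {v} = 0")
    case True
    have "deg w (insert v T) = 0"
      using deg_mono[OF w, of "{v}" "insert v T"] deg_nonneg[OF w, of "insert v T"] True by simp
    with True False show ?thesis by simp
  next
    case nz: False
    have "deg w {v} * deg (link w v) T
        = (\<Sum>e\<in>Pow V. if T \<subseteq> e \<and> v \<notin> e then w (insert v e) else 0)"
      unfolding deg_def[of "link w v"] sum_distrib_left link_def
      using nz by (intro sum.cong) auto
    also have "\<dots> = (\<Sum>e\<in>{e \<in> Pow V. T \<subseteq> e \<and> v \<notin> e}. w (insert v e))"
      using finite_V by (simp add: sum.If_cases Int_def)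
    also have "\<dots> = (\<Sum>e\<in>{e \<in> Pow V. insert v T \<subseteq> e}. w e)"
      using False v
      by (intro sum.reindex_bij_witness[of _ "\<lambda>e. e - {v}" "insert v"]) (auto simp: insert_absorb)
    also have "\<dots> = deg w (insert v T)"
      unfolding deg_def using finite_V by (simp add: sum.If_cases Int_def)
    finally show ?thesis using False by simp
  qed
qed

lemma uniform_weight_link:
  assumes w: "uniform_weight (Suc k) w"
  shows "uniform_weight k (link w v)"
  unfolding uniform_weight_def
proof (intro conjI allI impI)
  fix e
  show "0 \<le> link w v e"
    unfolding link_def using uniform_weightD(1)[OF w] deg_nonneg[OF w] by simp
next
  fix e assume "link w v e \<noteq> 0"
  then have v: "v \<notin> e" and nz: "w (insert v e) \<noteq> 0"
    unfolding link_def by (auto split: if_splits)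
  note e = uniform_weightD(2,3)[OF w nz]
  then have "finite e" using finite_V by (auto intro: finite_subset)
  with v e show "e \<subseteq> V" "card e = k" by auto
qed

lemma avoids_link:
  assumes "avoids w I" and "v \<in> I"
  shows "avoids (link w v) I"
  using assms unfolding avoids_def link_def by auto

lemma uniform_weight_add:
  "uniform_weight k x \<Longrightarrow> uniform_weight k y \<Longrightarrow> uniform_weight k (\<lambda>e. x e + y e)"
  unfolding uniform_weight_def by (auto simp: add_nonneg_eq_0_iff)

lemma energy_nonneg: "0 \<le> energy k x"
  unfolding pairing_def by (intro sum_nonneg mult_nonneg_nonneg[OF coeff_nonneg zero_le_square])

lemma energy_add:
  "energy k (\<lambda>e. x e + y e) = energy k x + 2 * pairing k x y + energy k y"
  unfolding pairing_def deg_add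
  by (simp add: sum.distrib[symmetric] sum_distrib_left algebra_simps)

lemma energy_divide: "energy k (\<lambda>e. x e / c) = energy k x / c\<^sup>2"
  unfolding pairing_def deg_divide sum_divide_distrib by (simp add: power2_eq_square)

text \<open>
  The degree of \<open>T\<close> in a random link is \<open>(k + 1 - t) / (k + 1)\<close> times its degree in the original weight
  on average; this factor turns \<open>(k + 1) choose t\<close> into \<open>k choose t\<close>, that is, the average link has the same
  degree measures. What is lost is the ratio of \<open>(k - 1) choose (t - 1)\<close> to \<open>k choose (t - 1)\<close>, at most 1.
\<close>

lemma coeff_mean:
  assumes "1 \<le> k"
  shows "coeff k t * (real (Suc k) - real t)\<^sup>2 \<le> (real (Suc k))\<^sup>2 * coeff (Suc k) t"
proof (cases "1 \<le> t \<and> t \<le> k")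
  case False
  then consider "t = 0" | "k < t" by linarith
  then show ?thesis
  proof cases
    case 2
    then have "coeff k t = 0" by (simp add: coeff_def)
    then show ?thesis using coeff_nonneg[of "Suc k" t] by simp
  qed (simp add: coeff_def)
next
  case True
  define a where "a = real (Suc k) - real t"
  have a: "0 < a" "a \<le> real k" unfolding a_def using True by auto
  have "(Suc k - t) * (Suc k choose t) = Suc k * (k choose t)"
    using binomial_absorb_comp[of "Suc k" t] by simp
  then have "real (Suc k - t) * real (Suc k choose t) = real (Suc k) * real (k choose t)"
    by (metis of_nat_mult)
  then have bin: "a * real (Suc k choose t) = real (Suc k) * real (k choose t)"
    using True unfolding a_def by (simp add: of_nat_diff)
  have pos: "0 < real (k choose t)" "0 < real (Suc k choose t)" using True by auto
  have recip: "1 / real (k choose t) = real (Suc k) / (a * real (Suc k choose t))"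
    unfolding bin using pos by simp
  have "coeff k t * a\<^sup>2 = real t * B ^ (t - 1) / real k * a\<^sup>2 * (1 / real (k choose t))"
    unfolding coeff_def by simp
  also have "\<dots> = (a / real k) * (real t * B ^ (t - 1) * real (Suc k) / real (Suc k choose t))"
    unfolding recip using a by (simp add: power2_eq_square)
  also have "\<dots> \<le> 1 * (real t * B ^ (t - 1) * real (Suc k) / real (Suc k choose t))"
    using a assms B_pos by (intro mult_right_mono) auto
  also have "\<dots> = (real (Suc k))\<^sup>2 * coeff (Suc k) t"
    unfolding coeff_def by (simp add: power2_eq_square)
  finally show ?thesis unfolding a_def .
qed

text \<open>
  This compares a set of size \<open>t - 1\<close> in a link with the set of size \<open>t\<close> that arises when the
  vertex of the link is added, in one of \<open>t\<close> ways. The energy at uniformity \<open>k + 1\<close> has one more factor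
  \<open>B\<close> for the larger set, which is the gain \<open>1 / B\<close>.
\<close>

lemma coeff_second_moment:
  assumes "1 \<le> k" and "1 \<le> t"
  shows "real t * coeff k (t - 1) \<le> real (Suc k) / B * coeff (Suc k) t"
proof (cases "2 \<le> t \<and> t \<le> Suc k")
  case False
  have nonneg: "0 \<le> real (Suc k) / B * coeff (Suc k) t"
    using coeff_nonneg B_pos by (intro mult_nonneg_nonneg) auto
  from False consider "t = 1" | "Suc k < t" using assms by linarith
  then show ?thesis
  proof cases
    case 2
    then have "k < t - 1" by linarith
    then have "k choose (t - 1) = 0" by (rule binomial_eq_0)
    then have "coeff k (t - 1) = 0" unfolding coeff_def by (simp only: of_nat_0 mult_zero_right div_by_0)
    then show ?thesis using nonneg by (simp only: mult_zero_right)
  next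
    case 1
    then have "coeff k (t - 1) = 0" by (simp add: coeff_def)
    then show ?thesis using nonneg by (simp only: mult_zero_right)
  qed
next
  case True
  then obtain r where r: "t = Suc (Suc r)" using that[of "t - 2"] by linarith
  have "Suc r \<le> k" using True r by simp
  have "t * (Suc k choose t) = Suc k * (k choose (t - 1))"
    using Suc_times_binomial_eq[of k "Suc r"] r by simp
  then have bin: "real t * real (Suc k choose t) = real (Suc k) * real (k choose (t - 1))"
    by (metis of_nat_mult)
  have pos: "0 < real (k choose (t - 1))" "0 < real (Suc k choose t)" using True by auto
  have recip: "1 / real (k choose (t - 1)) = real (Suc k) / (real t * real (Suc k choose t))"
    using pos(1) by (simp only: bin) simp
  have "real t * coeff k (t - 1)
      = real t * real (Suc r) * B ^ r / real k * (1 / real (k choose (t - 1)))"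
    unfolding coeff_def r by simp
  also have "\<dots> = (real (Suc r) / real k) * (B ^ r * real (Suc k) / real (Suc k choose t))"
    unfolding recip using True by simp
  also have "\<dots> \<le> (real t / real (Suc k)) * (B ^ r * real (Suc k) / real (Suc k choose t))"
  proof (intro mult_right_mono)
    show "real (Suc r) / real k \<le> real t / real (Suc k)"
      using \<open>Suc r \<le> k\<close> assms r by (simp add: field_simps)
  qed (use B_pos in auto)
  also have "\<dots> = real (Suc k) / B * coeff (Suc k) t"
  proof -
    have "t' / K * (b * K / C) = K / B * (t' * (B * b) / (K * C))" if "K \<noteq> 0" for t' K b C
      using that B_pos by simp
    moreover have "B ^ (t - 1) = B * B ^ r" unfolding r by simp
    ultimately show ?thesis unfolding coeff_def by simp
  qed
  finally show ?thesis .
qed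

lemma pairing_Cauchy_Schwarz:
  "(\<Sum>T\<in>Pow V. coeff k (card T) * (x T * y T))\<^sup>2
    \<le> (\<Sum>T\<in>Pow V. coeff k (card T) * (x T)\<^sup>2) * (\<Sum>T\<in>Pow V. coeff k (card T) * (y T)\<^sup>2)"
proof -
  define a where "a T = sqrt (coeff k (card T)) * x T" for T
  define b where "b T = sqrt (coeff k (card T)) * y T" for T
  have sqrt_sq: "(sqrt (coeff k t))\<^sup>2 = coeff k t" for t
    by (rule real_sqrt_pow2[OF coeff_nonneg])
  have ab: "a T * b T = coeff k (card T) * (x T * y T)" for T
  proof -
    have "a T * b T = (sqrt (coeff k (card T)))\<^sup>2 * (x T * y T)"
      unfolding a_def b_def power2_eq_square by (simp only: mult_ac)
    then show ?thesis unfolding sqrt_sq .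
  qed
  have aa: "(a T)\<^sup>2 = coeff k (card T) * (x T)\<^sup>2" and bb: "(b T)\<^sup>2 = coeff k (card T) * (y T)\<^sup>2" for T
    unfolding a_def b_def power_mult_distrib sqrt_sq by (rule refl)+
  show ?thesis
    using Cauchy_Schwarz_ineq_sum[of a b "Pow V"] unfolding ab aa bb .
qed

text \<open>
  Since the degrees of the average link are explicitly known, this is one application of Cauchy--Schwarz.
\<close>

lemma mean_pairing_link:
  assumes w: "uniform_weight (Suc k) w" and k: "1 \<le> k"
  shows "(\<Sum>v\<in>V. deg w {v} * pairing k z (link w v))
    \<le> real (Suc k) * (sqrt (energy k z) * sqrt (energy (Suc k) w))"
proof -
  define y where "y T = (real (Suc k) - real (card T)) * deg w T" for T
  have y: "(\<Sum>v\<in>V. deg w {v} * deg (link w v) T) = y T" if "T \<subseteq> V" for T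
  proof -
    have "(\<Sum>v\<in>V. deg w {v} * deg (link w v) T) = (\<Sum>v\<in>V. if v \<in> T then 0 else deg w (insert v T))"
      using deg_link[OF w] by (intro sum.cong) auto
    also have "\<dots> = (\<Sum>v\<in>V - T. deg w (insert v T))"
      using finite_V by (simp add: sum.If_cases Diff_eq Compl_eq)
    also have "\<dots> = y T"
      unfolding y_def by (rule sum_deg_insert[OF w that])
    finally show ?thesis .
  qed
  have "(\<Sum>v\<in>V. deg w {v} * pairing k z (link w v))
      = (\<Sum>T\<in>Pow V. \<Sum>v\<in>V. deg w {v} * (coeff k (card T) * (deg z T * deg (link w v) T)))"
    unfolding pairing_def sum_distrib_left by (rule sum.swap)
  also have "\<dots> = (\<Sum>T\<in>Pow V. coeff k (card T) * (deg z T * y T))"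
  proof (rule sum.cong[OF refl])
    fix T assume "T \<in> Pow V"
    then have "coeff k (card T) * (deg z T * y T)
        = coeff k (card T) * (deg z T * (\<Sum>v\<in>V. deg w {v} * deg (link w v) T))"
      using y by simp
    also have "\<dots> = (\<Sum>v\<in>V. deg w {v} * (coeff k (card T) * (deg z T * deg (link w v) T)))"
      unfolding sum_distrib_left by (simp only: mult_ac)
    finally show "(\<Sum>v\<in>V. deg w {v} * (coeff k (card T) * (deg z T * deg (link w v) T)))
        = coeff k (card T) * (deg z T * y T)" by (rule sym)
  qed
  finally have eq: "(\<Sum>v\<in>V. deg w {v} * pairing k z (link w v))
      = (\<Sum>T\<in>Pow V. coeff k (card T) * (deg z T * y T))" .
  have "(\<Sum>T\<in>Pow V. coeff k (card T) * (y T)\<^sup>2)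
      \<le> (\<Sum>T\<in>Pow V. (real (Suc k))\<^sup>2 * coeff (Suc k) (card T) * (deg w T)\<^sup>2)"
  proof (rule sum_mono)
    fix T
    show "coeff k (card T) * (y T)\<^sup>2 \<le> (real (Suc k))\<^sup>2 * coeff (Suc k) (card T) * (deg w T)\<^sup>2"
      using mult_right_mono[OF coeff_mean[OF k, of "card T"], of "(deg w T)\<^sup>2"]
      unfolding y_def by (simp add: power_mult_distrib mult.assoc)
  qed
  also have "\<dots> = (real (Suc k))\<^sup>2 * energy (Suc k) w"
    unfolding pairing_def sum_distrib_left by (simp add: power2_eq_square mult.assoc)
  finally have "(\<Sum>T\<in>Pow V. coeff k (card T) * (y T)\<^sup>2) \<le> (real (Suc k))\<^sup>2 * energy (Suc k) w" .
  then have "(\<Sum>T\<in>Pow V. coeff k (card T) * (deg z T * y T))\<^sup>2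
      \<le> energy k z * ((real (Suc k))\<^sup>2 * energy (Suc k) w)"
    using pairing_Cauchy_Schwarz[of k "deg z" y] mult_left_mono[OF _ energy_nonneg[of k z]]
    by (fastforce simp: pairing_def power2_eq_square intro: order_trans)
  then have "(\<Sum>T\<in>Pow V. coeff k (card T) * (deg z T * y T))
      \<le> sqrt (energy k z * ((real (Suc k))\<^sup>2 * energy (Suc k) w))"
    by (rule real_le_rsqrt)
  also have "\<dots> = real (Suc k) * (sqrt (energy k z) * sqrt (energy (Suc k) w))"
    by (simp add: real_sqrt_mult)
  finally show ?thesis unfolding eq .
qed

text \<open>
  A link divides by the degree of its vertex, and its energy by the square of that. One of the two
  factors is compensated by the probability of \<open>v\<close>; the other is the reason for the lower bound
  \<open>\<theta>\<close> on the degrees. What remains is a sum over pairs of a vertex and a set containing it.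
\<close>

lemma mean_energy_link:
  assumes w: "uniform_weight (Suc k) w" and k: "1 \<le> k" and \<theta>: "0 < \<theta>"
    and G: "G \<subseteq> V" "\<And>v. v \<in> G \<Longrightarrow> \<theta> \<le> deg w {v}"
  shows "(\<Sum>v\<in>G. deg w {v} * energy k (link w v)) \<le> real (Suc k) / (\<theta> * B) * energy (Suc k) w"
proof -
  define h where "h v = (\<Sum>T\<in>Pow V. if v \<in> T then 0 else coeff k (card T) * (deg w (insert v T))\<^sup>2)" for v
  have h: "(deg w {v})\<^sup>2 * energy k (link w v) = h v" if "v \<in> V" for v
  proof -
    have "(deg w {v})\<^sup>2 * energy k (link w v)
        = (\<Sum>T\<in>Pow V. coeff k (card T) * (deg w {v} * deg (link w v) T)\<^sup>2)"
      unfolding pairing_def sum_distrib_left by (simp add: power2_eq_square algebra_simps)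
    also have "\<dots> = h v"
      unfolding h_def deg_link[OF w that] by (intro sum.cong) auto
    finally show ?thesis .
  qed
  have h_eq: "h v = (\<Sum>T\<in>Pow V. if v \<in> T then coeff k (card T - 1) * (deg w T)\<^sup>2 else 0)"
    if v: "v \<in> V" for v
  proof -
    have "h v = (\<Sum>T\<in>{T \<in> Pow V. v \<notin> T}. coeff k (card T) * (deg w (insert v T))\<^sup>2)"
      unfolding h_def using finite_V by (simp add: sum.If_cases Int_def)
    also have "\<dots> = (\<Sum>T\<in>{T \<in> Pow V. v \<in> T}. coeff k (card T - 1) * (deg w T)\<^sup>2)"
      using v finite_V
      by (intro sum.reindex_bij_witness[of _ "\<lambda>T. T - {v}" "insert v"])
         (auto simp: insert_absorb card_insert_if finite_subset[OF _ finite_V])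
    also have "\<dots> = (\<Sum>T\<in>Pow V. if v \<in> T then coeff k (card T - 1) * (deg w T)\<^sup>2 else 0)"
      using finite_V by (simp add: sum.If_cases Int_def)
    finally show ?thesis .
  qed
  have h_nonneg: "0 \<le> h v" for v
    unfolding h_def by (intro sum_nonneg) (auto simp: coeff_nonneg)
  have "\<theta> * (\<Sum>v\<in>G. deg w {v} * energy k (link w v))
      = (\<Sum>v\<in>G. \<theta> * (deg w {v} * energy k (link w v)))"
    by (rule sum_distrib_left)
  also have "\<dots> \<le> (\<Sum>v\<in>G. h v)"
  proof (rule sum_mono)
    fix v assume v: "v \<in> G"
    have "\<theta> * (deg w {v} * energy k (link w v)) \<le> deg w {v} * (deg w {v} * energy k (link w v))"
      using G(2)[OF v] deg_nonneg[OF w, of "{v}"] energy_nonneg[of k "link w v"]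
      by (intro mult_right_mono) auto
    also have "\<dots> = h v"
      using h[of v] v G(1) by (auto simp: power2_eq_square mult.assoc)
    finally show "\<theta> * (deg w {v} * energy k (link w v)) \<le> h v" .
  qed
  also have "\<dots> \<le> (\<Sum>v\<in>V. h v)"
    using finite_V G(1) h_nonneg by (intro sum_mono2) auto
  also have "\<dots> = (\<Sum>v\<in>V. \<Sum>T\<in>Pow V. if v \<in> T then coeff k (card T - 1) * (deg w T)\<^sup>2 else 0)"
    using h_eq by (intro sum.cong) auto
  also have "\<dots> = (\<Sum>T\<in>Pow V. \<Sum>v\<in>V. if v \<in> T then coeff k (card T - 1) * (deg w T)\<^sup>2 else 0)"
    by (rule sum.swap)
  also have "\<dots> = (\<Sum>T\<in>Pow V. real (card T) * coeff k (card T - 1) * (deg w T)\<^sup>2)"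
    using finite_V by (intro sum.cong) (auto simp: sum.If_cases Int_absorb1)
  also have "\<dots> \<le> (\<Sum>T\<in>Pow V. real (Suc k) / B * coeff (Suc k) (card T) * (deg w T)\<^sup>2)"
  proof (rule sum_mono)
    fix T :: "'a set"
    have "real (card T) * coeff k (card T - 1) \<le> real (Suc k) / B * coeff (Suc k) (card T)"
      using coeff_second_moment[OF k, of "card T"] by (cases "card T = 0") (auto simp: coeff_def)
    then show "real (card T) * coeff k (card T - 1) * (deg w T)\<^sup>2
        \<le> real (Suc k) / B * coeff (Suc k) (card T) * (deg w T)\<^sup>2"
      by (rule mult_right_mono) simp
  qed
  also have "\<dots> = real (Suc k) / B * energy (Suc k) w"
    unfolding pairing_def sum_distrib_left by (simp add: power2_eq_square mult.assoc)
  finally show ?thesis using \<theta> B_pos by (simp add: field_simps)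
qed

text \<open>
  Cauchy--Schwarz for the terms of the energy that belong to singletons, whose coefficient is
  \<open>1 / k\<^sup>2\<close>. It is used twice: few vertices carry little degree, and, at uniformity 1, the
  support of a weight of small energy is large.
\<close>

lemma sum_deg_le_energy:
  assumes "1 \<le> k" and N: "N \<subseteq> V"
  shows "(\<Sum>v\<in>N. deg w {v})\<^sup>2 \<le> (real k)\<^sup>2 * (real (card N) * energy k w)"
proof -
  have finN: "finite N" using N finite_V by (rule finite_subset)
  have "(\<Sum>v\<in>N. (deg w {v})\<^sup>2) = (real k)\<^sup>2 * (\<Sum>v\<in>N. coeff k (card {v}) * (deg w {v} * deg w {v}))"
    using assms(1) unfolding coeff_def sum_distrib_left by (simp add: power2_eq_square)
  also have "(\<Sum>v\<in>N. coeff k (card {v}) * (deg w {v} * deg w {v}))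
      = (\<Sum>T\<in>(\<lambda>v. {v}) ` N. coeff k (card T) * (deg w T * deg w T))"
    by (simp add: sum.reindex)
  also have "\<dots> \<le> energy k w"
    unfolding pairing_def using finite_V N coeff_nonneg by (intro sum_mono2) auto
  finally have sq: "(\<Sum>v\<in>N. (deg w {v})\<^sup>2) \<le> (real k)\<^sup>2 * energy k w"
    by (simp add: mult_left_mono)
  have "(\<Sum>v\<in>N. deg w {v})\<^sup>2 \<le> (\<Sum>v\<in>N. (deg w {v})\<^sup>2) * real (card N)"
    using sum_squared_le_sum_of_squares[of "\<lambda>v. deg w {v}" N] by simp
  also have "\<dots> \<le> (real k)\<^sup>2 * energy k w * real (card N)"
    using sq by (rule mult_right_mono) simp
  finally show ?thesis by (simp add: algebra_simps)
qed

text \<open>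
  Averaging with weights \<open>deg w {v}\<close> over the available vertices of degree at least \<open>\<theta>\<close>. Only the total mass \<open>c\<close>
  of the available vertices matters: the cross terms are nonnegative, so their sum may be extended to
  all vertices.
\<close>

lemma exists_good_link:
  assumes w: "uniform_weight (Suc k) w" and k: "1 \<le> k"
    and z: "uniform_weight k z" and \<theta>: "0 < \<theta>" and "0 < c"
    and mass: "c \<le> (\<Sum>v\<in>{v \<in> V - N. \<theta> \<le> deg w {v}}. deg w {v})"
  shows "\<exists>v\<in>V - N. \<theta> \<le> deg w {v} \<and> energy k (\<lambda>e. z e + link w v e) \<le> energy k z +
    (2 * real (Suc k) * (sqrt (energy k z) * sqrt (energy (Suc k) w))
      + real (Suc k) / (\<theta> * B) * energy (Suc k) w) / c"
proof (rule ccontr)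
  define G where "G = {v \<in> V - N. \<theta> \<le> deg w {v}}"
  define h where "h v = 2 * pairing k z (link w v) + energy k (link w v)" for v
  define A where "A = 2 * real (Suc k) * (sqrt (energy k z) * sqrt (energy (Suc k) w))
      + real (Suc k) / (\<theta> * B) * energy (Suc k) w"
  assume "\<not> ?thesis"
  then have big: "A / c < h v" if "v \<in> G" for v
    using that unfolding G_def h_def A_def energy_add by force
  have A: "0 \<le> A"
    unfolding A_def using energy_nonneg \<theta> B_pos by simp
  have finG: "finite G" "G \<subseteq> V" unfolding G_def using finite_V by auto
  have nonneg: "0 \<le> deg w {v} * pairing k z (link w v)" for v
    unfolding pairing_def
    using deg_nonneg[OF w] deg_nonneg[OF z] deg_nonneg[OF uniform_weight_link[OF w]] coeff_nonneg
    by (intro mult_nonneg_nonneg sum_nonneg) auto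
  have "G \<noteq> {}"
  proof
    assume "G = {}"
    then show False using mass \<open>0 < c\<close> unfolding G_def[symmetric] by simp
  qed
  have "A \<le> A / c * (\<Sum>v\<in>G. deg w {v})"
    using mult_left_mono[OF mass, of "A / c"] A \<open>0 < c\<close> unfolding G_def by simp
  also have "\<dots> = (\<Sum>v\<in>G. deg w {v} * (A / c))"
    by (simp add: sum_distrib_left mult.commute)
  also have "\<dots> < (\<Sum>v\<in>G. deg w {v} * h v)"
  proof (rule sum_strict_mono[OF finG(1) \<open>G \<noteq> {}\<close>])
    fix v assume v: "v \<in> G"
    then have "0 < deg w {v}" using \<theta> unfolding G_def by auto
    then show "deg w {v} * (A / c) < deg w {v} * h v" using big[OF v] by (rule mult_strict_left_mono[rotated])
  qed
  also have "\<dots> = 2 * (\<Sum>v\<in>G. deg w {v} * pairing k z (link w v))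
      + (\<Sum>v\<in>G. deg w {v} * energy k (link w v))"
    unfolding h_def by (simp add: sum_distrib_left sum.distrib algebra_simps)
  also have "\<dots> \<le> 2 * (\<Sum>v\<in>V. deg w {v} * pairing k z (link w v))
      + (\<Sum>v\<in>G. deg w {v} * energy k (link w v))"
    using finite_V finG nonneg by (intro add_right_mono mult_left_mono sum_mono2) auto
  also have "\<dots> \<le> A"
  proof -
    have "(\<Sum>v\<in>G. deg w {v} * energy k (link w v)) \<le> real (Suc k) / (\<theta> * B) * energy (Suc k) w"
      by (rule mean_energy_link[OF w k \<theta> finG(2)]) (simp add: G_def)
    then show ?thesis
      using mean_pairing_link[OF w k, of z] unfolding A_def by linarith
  qed
  finally show False by simp
qed

text \<open>
  In units of \<open>k + 1\<close>, the vertices of small degree carry at most \<open>1 / (4 * s)\<close>, and the vertices of \<open>N\<close>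
  at most \<open>sqrt 0.27 / s\<^sup>2 \<le> 0.26 / s\<close> since \<open>s \<ge> 2\<close>. The rest is at least \<open>s / (s + 1)\<close>, the inverse
  of \<open>1 + 1 / s\<close>.
\<close>

lemma mass_of_good_vertices:
  assumes w: "uniform_weight (Suc k) w" and one: "deg w {} = 1"
    and s: "2 \<le> s" and N: "N \<subseteq> V" and "0 < card V"
    and small: "real (card N) * energy (Suc k) w \<le> 27 / (100 * real s ^ 4)"
  shows "real (Suc k) * (real s / (real s + 1))
    \<le> (\<Sum>v\<in>{v \<in> V - N. real (Suc k) / (4 * real s * real (card V)) \<le> deg w {v}}. deg w {v})"
proof -
  define \<theta> where "\<theta> = real (Suc k) / (4 * real s * real (card V))"
  define G where "G = {v \<in> V - N. \<theta> \<le> deg w {v}}"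
  define L where "L = {v \<in> V - N. \<not> \<theta> \<le> deg w {v}}"
  have s0: "2 \<le> real s" using s by simp
  have total: "(\<Sum>v\<in>V. deg w {v}) = real (Suc k)"
    using sum_deg_insert[OF w, of "{}"] one by simp
  have split: "(\<Sum>v\<in>V. deg w {v}) = (\<Sum>v\<in>N. deg w {v}) + ((\<Sum>v\<in>G. deg w {v}) + (\<Sum>v\<in>L. deg w {v}))"
  proof -
    have "(\<Sum>v\<in>V. deg w {v}) = (\<Sum>v\<in>N. deg w {v}) + (\<Sum>v\<in>V - N. deg w {v})"
      using sum.subset_diff[OF N finite_V, of "\<lambda>v. deg w {v}"] by simp
    also have "V - N = G \<union> L" unfolding G_def L_def by auto
    also have "(\<Sum>v\<in>G \<union> L. deg w {v}) = (\<Sum>v\<in>G. deg w {v}) + (\<Sum>v\<in>L. deg w {v})"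
      using finite_V unfolding G_def L_def by (intro sum.union_disjoint) auto
    finally show ?thesis .
  qed
  have "(\<Sum>v\<in>L. deg w {v}) \<le> real (card L) * \<theta>"
    by (rule sum_bounded_above) (auto simp: L_def)
  also have "\<dots> \<le> real (card V) * \<theta>"
    using finite_V by (intro mult_right_mono) (auto simp: L_def \<theta>_def intro!: card_mono)
  also have "\<dots> = real (Suc k) * (25 / (100 * real s))"
    using \<open>0 < card V\<close> unfolding \<theta>_def by simp
  finally have low: "(\<Sum>v\<in>L. deg w {v}) \<le> real (Suc k) * (25 / (100 * real s))" .
  have "27 / (100 * real s ^ 4) \<le> (26 / (100 * real s))\<^sup>2"
  proof -
    have "4 \<le> real s ^ 2" using power_mono[OF s0, of 2] by simp
    then show ?thesis using s0 by (simp add: field_simps power2_eq_square power4_eq_xxxx)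
  qed
  with small have "real (card N) * energy (Suc k) w \<le> (26 / (100 * real s))\<^sup>2" by simp
  then have "(real (Suc k))\<^sup>2 * (real (card N) * energy (Suc k) w)
      \<le> (real (Suc k))\<^sup>2 * (26 / (100 * real s))\<^sup>2"
    by (rule mult_left_mono) simp
  with sum_deg_le_energy[of "Suc k" N w] N
  have "(\<Sum>v\<in>N. deg w {v})\<^sup>2 \<le> (real (Suc k) * (26 / (100 * real s)))\<^sup>2"
    unfolding power_mult_distrib[of "real (Suc k)"] by linarith
  then have no: "(\<Sum>v\<in>N. deg w {v}) \<le> real (Suc k) * (26 / (100 * real s))"
    by (rule power2_le_imp_le) simp
  have "real s / (real s + 1) \<le> 1 - 26 / (100 * real s) - 25 / (100 * real s)"
    using s0 by (simp add: field_simps)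
  then have "real (Suc k) * (real s / (real s + 1))
      \<le> real (Suc k) * (1 - 26 / (100 * real s) - 25 / (100 * real s))"
    by (rule mult_left_mono) simp
  also have "\<dots> = real (Suc k) - real (Suc k) * (26 / (100 * real s)) - real (Suc k) * (25 / (100 * real s))"
    by (simp only: right_diff_distrib mult_1_right)
  also have "\<dots> \<le> (\<Sum>v\<in>G. deg w {v})"
    using low no split total by linarith
  finally show ?thesis unfolding G_def \<theta>_def .
qed

end

text \<open>
  Here \<open>x\<close> is the energy of the sum of the links found so far, \<open>M\<close> bounds the norm of the average link and
  \<open>r * M\<^sup>2\<close> the mean energy of a link. The bound \<open>sqrt x \<le> M * a\<close> with \<open>a = j\<close> after \<open>j\<close> steps would be ideal, but the
  term \<open>r\<close> destroys it. With the initial surplus \<open>L\<close> and a speed that is larger by \<open>\<epsilon>\<close>, the extra growth of the square by at least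
  \<open>2 * \<epsilon> * L * M\<^sup>2\<close> in each step pays for \<open>r * M\<^sup>2\<close>.
\<close>

lemma square_recurrence:
  fixes x M r \<epsilon> L :: real
  assumes "0 \<le> M" "0 < \<epsilon>" "0 \<le> L" "0 \<le> a" and r: "r \<le> 2 * \<epsilon> * L" and x: "x \<le> (M * (a + L))\<^sup>2"
  shows "x + 2 * sqrt x * M + r * M\<^sup>2 \<le> (M * (a + (1 + \<epsilon>) + L))\<^sup>2"
proof -
  have "sqrt x \<le> M * (a + L)"
    using x assms by (simp add: real_le_lsqrt)
  then have "sqrt x * M \<le> M * (a + L) * M" using \<open>0 \<le> M\<close> by (rule mult_right_mono)
  moreover have "r * M\<^sup>2 \<le> 2 * \<epsilon> * L * M\<^sup>2" using r by (rule mult_right_mono) simp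
  moreover have "0 \<le> M\<^sup>2 * (2 * \<epsilon> * a + (1 + \<epsilon>)\<^sup>2)" using assms by simp
  moreover have "(M * (a + (1 + \<epsilon>) + L))\<^sup>2
      = (M * (a + L))\<^sup>2 + 2 * (M * (a + L) * M) + 2 * \<epsilon> * L * M\<^sup>2 + M\<^sup>2 * (2 * \<epsilon> * a + (1 + \<epsilon>)\<^sup>2)"
    by (simp add: power2_eq_square algebra_simps)
  ultimately show ?thesis using x by linarith
qed

context weighted_ground begin

text \<open>
  In \<open>variance\<close>, the left-hand side is a bound \<open>r\<close> on the ratio of the mean energy of a link to the
  energy of \<open>w\<close>. It is applied with \<open>\<epsilon> = 1 / (2 * s)\<close> and \<open>L = r * s\<close> in the recurrence above, so \<open>m\<close> links suffice to
  make \<open>L / m\<close> at most \<open>1 / (2 * s)\<close>. The norm grows by \<open>1 + 1 / s\<close> because of the vertices that are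
  not available, and by \<open>1 + 1 / s\<close> because of \<open>\<epsilon>\<close> and \<open>L\<close>; this gives the fourth power for the energy.
\<close>

lemma coverable_round:
  fixes s m :: nat and \<delta> :: real
  assumes k: "1 \<le> k" "Suc k \<le> s" and w: "uniform_weight (Suc k) w" and one: "deg w {} = 1"
    and n: "0 < card V" and m: "0 < m"
    and small: "\<delta> * real (card V) * energy (Suc k) w \<le> 27 / (100 * real s ^ 4)"
    and variance: "4 * real s * real (card V) / (real (Suc k) * B) \<le> real m / (2 * (real s)\<^sup>2)"
    and many_no: "\<And>N. N \<subseteq> V \<Longrightarrow> \<delta> * real (card V) \<le> real (card N) \<Longrightarrow> P (V - N)"
    and next_round: "\<And>z. uniform_weight k z \<Longrightarrow> deg z {} = 1 \<Longrightarrow>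
        energy k z \<le> (1 + 1 / real s) ^ 4 * energy (Suc k) w \<Longrightarrow>
        coverable P {I. I \<subseteq> V \<and> avoids z I} b"
  shows "coverable P {I. I \<subseteq> V \<and> avoids w I} (b + m)"
proof -
  have s: "2 \<le> s" "0 < real s" using k by auto
  define Q where "Q = energy (Suc k) w"
  have Q: "0 \<le> Q" unfolding Q_def by (rule energy_nonneg)
  define \<theta> where "\<theta> = real (Suc k) / (4 * real s * real (card V))"
  have \<theta>: "0 < \<theta>" unfolding \<theta>_def using n s by simp
  define r where "r = 1 / (\<theta> * B)"
  have r: "0 \<le> r" unfolding r_def using \<theta> B_pos by simp
  have r_le: "r \<le> real m / (2 * (real s)\<^sup>2)"
    using variance unfolding r_def \<theta>_def by simp
  define M where "M = (1 + 1 / real s) * sqrt Q"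
  have M: "0 \<le> M" unfolding M_def using s Q by simp
  define step where "step = 1 + 1 / (2 * real s)"
  define reach where "reach j z \<longleftrightarrow> uniform_weight k z \<and> deg z {} = real j \<and>
      energy k z \<le> (M * (real j * step + r * real s))\<^sup>2" for j z
  have "coverable P {I \<in> {I. I \<subseteq> V \<and> avoids w I}. avoids (\<lambda>e. 0) I \<and> I \<inter> {} = {}} (b + (m - 0))"
  proof (rule coverable_by_selection[where P = P and V = V and d = "\<delta> * real (card V)" and reach = reach])
    fix N assume "N \<subseteq> V" "\<delta> * real (card V) \<le> real (card N)"
    then show "P (V - N)" by (rule many_no)
  next
    fix j z N
    assume "j < m" and reach: "reach j z" and N: "N \<subseteq> V" and few: "real (card N) < \<delta> * real (card V)"
    have z: "uniform_weight k z" "deg z {} = real j"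
      and en: "energy k z \<le> (M * (real j * step + r * real s))\<^sup>2"
      using reach unfolding reach_def by auto
    define c where "c = real (Suc k) * (real s / (real s + 1))"
    have c: "0 < c" unfolding c_def using s by simp
    have "real (card N) * energy (Suc k) w \<le> \<delta> * real (card V) * energy (Suc k) w"
      using few energy_nonneg by (intro mult_right_mono) auto
    then have "c \<le> (\<Sum>v\<in>{v \<in> V - N. \<theta> \<le> deg w {v}}. deg w {v})"
      unfolding c_def \<theta>_def using small by (intro mass_of_good_vertices[OF w one s(1) N n]) simp
    from exists_good_link[OF w k(1) z(1) \<theta> c this]
    obtain v where v: "v \<in> V - N" "\<theta> \<le> deg w {v}"
      and le: "energy k (\<lambda>e. z e + link w v e) \<le> energy k z +
        (2 * real (Suc k) * (sqrt (energy k z) * sqrt Q) + real (Suc k) / (\<theta> * B) * Q) / c"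
      unfolding Q_def by blast
    have "(2 * real (Suc k) * (sqrt (energy k z) * sqrt Q) + real (Suc k) / (\<theta> * B) * Q) / c
        = (1 + 1 / real s) * (2 * (sqrt (energy k z) * sqrt Q) + r * Q)"
    proof -
      have "(2 * real (Suc k) * (sqrt (energy k z) * sqrt Q) + real (Suc k) / (\<theta> * B) * Q)
          = real (Suc k) * (2 * (sqrt (energy k z) * sqrt Q) + r * Q)"
        unfolding r_def by (simp add: algebra_simps)
      moreover have "real (Suc k) * x / c = (1 + 1 / real s) * x" for x
        unfolding c_def using s(2) by (simp add: divide_simps)
      ultimately show ?thesis by simp
    qed
    also have "\<dots> = 2 * sqrt (energy k z) * M + (1 + 1 / real s) * (r * Q)"
      unfolding M_def by (simp add: algebra_simps)
    also have "(1 + 1 / real s) * (r * Q) \<le> (1 + 1 / real s)\<^sup>2 * (r * Q)"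
      using s(2) r Q by (intro mult_right_mono self_le_power) auto
    also have "\<dots> = r * M\<^sup>2"
      unfolding M_def using Q by (simp add: power_mult_distrib)
    finally have "energy k (\<lambda>e. z e + link w v e)
        \<le> energy k z + 2 * sqrt (energy k z) * M + r * M\<^sup>2"
      using le by simp
    also have "\<dots> \<le> (M * (real j * step + (1 + 1 / (2 * real s)) + r * real s))\<^sup>2"
      using M s r en by (intro square_recurrence) (auto simp: step_def)
    also have "real j * step + (1 + 1 / (2 * real s)) = real (Suc j) * step"
      unfolding step_def[symmetric] of_nat_Suc by (simp add: algebra_simps)
    finally have "energy k (\<lambda>e. z e + link w v e) \<le> (M * (real (Suc j) * step + r * real s))\<^sup>2" .
    moreover have "deg (link w v) {} = 1"
      using deg_link[OF w, of v "{}"] v \<theta> by simp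
    ultimately have "reach (Suc j) (\<lambda>e. z e + link w v e)"
      unfolding reach_def using z uniform_weight_add[OF z(1) uniform_weight_link[OF w]]
      by (simp add: deg_add)
    moreover have "avoids (\<lambda>e. z e + link w v e) I"
      if "I \<in> {I. I \<subseteq> V \<and> avoids w I}" "v \<in> I" "avoids z I" for I
      using that avoids_link[of w I v] unfolding avoids_def by auto
    ultimately show "\<exists>v\<in>V - N. \<exists>z'. reach (Suc j) z' \<and>
        (\<forall>I\<in>{I. I \<subseteq> V \<and> avoids w I}. v \<in> I \<longrightarrow> avoids z I \<longrightarrow> avoids z' I)"
      using v(1) by blast
  next
    fix z assume "reach m z"
    then have z: "uniform_weight k z" "deg z {} = real m"
      and en: "energy k z \<le> (M * (real m * step + r * real s))\<^sup>2"
      unfolding reach_def by auto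
    define y where "y e = z e / real m" for e
    have y: "uniform_weight k y" "deg y {} = 1"
      using z m unfolding y_def uniform_weight_def by (auto simp: deg_divide)
    have "r * real s \<le> real m / (2 * (real s)\<^sup>2) * real s"
      using r_le by (rule mult_right_mono) simp
    also have "\<dots> = real m / (2 * real s)"
      by (simp add: power2_eq_square)
    finally have "real m * step + r * real s \<le> real m * (1 + 1 / real s)"
      unfolding step_def using s by (simp add: field_simps)
    then have "M * (real m * step + r * real s) \<le> M * (real m * (1 + 1 / real s))"
      using M by (rule mult_left_mono)
    then have "(M * (real m * step + r * real s))\<^sup>2 \<le> (M * (real m * (1 + 1 / real s)))\<^sup>2"
      using M s r by (intro power_mono) (auto simp: step_def)
    also have "\<dots> = (1 + 1 / real s) ^ 4 * Q * (real m)\<^sup>2"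
      unfolding M_def using Q by (simp add: power_mult_distrib power2_eq_square power4_eq_xxxx)
    finally have "energy k y \<le> (1 + 1 / real s) ^ 4 * Q"
      using en m unfolding y_def energy_divide by (simp add: divide_simps)
    then have "coverable P {I. I \<subseteq> V \<and> avoids y I} b"
      using next_round[OF y] unfolding Q_def by simp
    moreover have "avoids y I = avoids z I" for I
      unfolding avoids_def y_def using m by simp
    ultimately show "coverable P {I. I \<subseteq> V \<and> avoids z I} b" by simp
  next
    show "reach 0 (\<lambda>e. 0)"
      unfolding reach_def by (simp add: uniform_weight_def deg_zero pairing_def)
  qed (use finite_V in auto)
  then show ?thesis unfolding avoids_def by simp
qed

text \<open>
  Over all rounds the energy grows at most by \<open>((1 + 1 / s) ^ s) ^ 4 \<le> 3 ^ 4 = 81\<close>. Since the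
  hypothesis of the theorem leaves room for a factor of \<open>300 * s ^ 4\<close>, the energy is small enough
  for the next round throughout, and the support of the final weight on vertices is large enough.
\<close>

lemma coverable_independent:
  fixes s m :: nat and \<delta> :: real
  assumes n: "0 < card V" and m: "0 < m" and "0 < \<delta>"
    and variance: "\<And>k. 1 \<le> k \<Longrightarrow>
        4 * real s * real (card V) / (real (Suc k) * B) \<le> real m / (2 * (real s)\<^sup>2)"
    and many_no: "\<And>N. N \<subseteq> V \<Longrightarrow> \<delta> * real (card V) \<le> real (card N) \<Longrightarrow> P (V - N)"
  shows "1 \<le> k \<Longrightarrow> k \<le> s \<Longrightarrow> uniform_weight k w \<Longrightarrow> deg w {} = 1 \<Longrightarrow>
    \<delta> * real (card V) * energy k w \<le> (1 + 1 / real s) ^ (4 * (s - k)) / (300 * real s ^ 4) \<Longrightarrow>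
    coverable P {I. I \<subseteq> V \<and> avoids w I} ((k - 1) * m)"
proof (induction k arbitrary: w)
  case 0
  then show ?case by simp
next
  case (Suc k)
  note w = Suc.prems(3) and one = Suc.prems(4)
  have s: "1 \<le> real s" using Suc.prems by simp
  have "(1 + 1 / real s) ^ s \<le> exp (1 / real s) ^ s"
    using s by (intro power_mono exp_ge_add_one_self) auto
  also have "\<dots> = exp 1"
    using s by (simp add: exp_of_nat_mult[symmetric])
  also have "\<dots> \<le> 3" by (rule exp_le)
  finally have three: "(1 + 1 / real s) ^ s \<le> 3" .
  have "(1 + 1 / real s) ^ (4 * (s - Suc k)) \<le> (1 + 1 / real s) ^ (s * 4)"
    using s by (intro power_increasing) auto
  also have "\<dots> \<le> 3 ^ 4"
    unfolding power_mult using three s by (intro power_mono) auto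
  finally have "(1 + 1 / real s) ^ (4 * (s - Suc k)) / (300 * real s ^ 4) \<le> 81 / (300 * real s ^ 4)"
    using s by (intro divide_right_mono) auto
  then have small: "\<delta> * real (card V) * energy (Suc k) w \<le> 27 / (100 * real s ^ 4)"
    using Suc.prems(5) by simp
  show ?case
  proof (cases "k = 0")
    case True
    define N where "N = {v \<in> V. deg w {v} \<noteq> 0}"
    have N: "N \<subseteq> V" unfolding N_def by auto
    have "(\<Sum>v\<in>N. deg w {v}) = (\<Sum>v\<in>V. deg w {v})"
      unfolding N_def using finite_V by (intro sum.mono_neutral_left) auto
    also have "\<dots> = 1"
      using sum_deg_insert[OF w, of "{}"] one True by simp
    finally have "1 \<le> real (card N) * energy (Suc k) w"
      using sum_deg_le_energy[of "Suc k" N w] N True by simp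
    then have "\<delta> * real (card V) * 1 \<le> \<delta> * real (card V) * (real (card N) * energy (Suc k) w)"
      using \<open>0 < \<delta>\<close> by (intro mult_left_mono) auto
    also have "\<dots> = real (card N) * (\<delta> * real (card V) * energy (Suc k) w)" by simp
    also have "\<dots> \<le> real (card N) * 1"
    proof (rule mult_left_mono)
      have "27 / (100 * real s ^ 4) \<le> 1" using one_le_power[OF s, of 4] by (simp add: divide_simps)
      with small show "\<delta> * real (card V) * energy (Suc k) w \<le> 1" by linarith
    qed simp
    finally have "P (V - N)" using many_no[OF N] by simp
    moreover have "I \<subseteq> V - N" if I: "I \<in> {I. I \<subseteq> V \<and> avoids w I}" for I
    proof
      fix v assume v: "v \<in> I"
      have "deg w {v} = 0"
        unfolding deg_def
      proof (intro sum.neutral ballI)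
        fix e assume "e \<in> Pow V"
        show "(if {v} \<subseteq> e then w e else 0) = 0"
        proof (rule ccontr)
          assume nz: "(if {v} \<subseteq> e then w e else 0) \<noteq> 0"
          then have "v \<in> e" "card e = 1"
            using uniform_weightD(3)[OF w] True by (auto split: if_splits)
          then have "e = {v}" by (auto simp: card_1_singleton_iff)
          with nz I v show False unfolding avoids_def by auto
        qed
      qed
      with v I show "v \<in> V - N" unfolding N_def by auto
    qed
    ultimately show ?thesis by (rule coverable_leaf[where C = "V - N"])
  next
    case False
    then have k: "1 \<le> k" by simp
    have "coverable P {I. I \<subseteq> V \<and> avoids w I} ((k - 1) * m + m)"
    proof (rule coverable_round[where P = P, OF k Suc.prems(2) w one n m small variance[OF k] many_no])
      fix z assume z: "uniform_weight k z" "deg z {} = 1"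
        and en: "energy k z \<le> (1 + 1 / real s) ^ 4 * energy (Suc k) w"
      have "\<delta> * real (card V) * energy k z
          \<le> \<delta> * real (card V) * ((1 + 1 / real s) ^ 4 * energy (Suc k) w)"
        using en \<open>0 < \<delta>\<close> by (intro mult_left_mono) auto
      also have "\<dots> = (1 + 1 / real s) ^ 4 * (\<delta> * real (card V) * energy (Suc k) w)" by simp
      also have "\<dots> \<le> (1 + 1 / real s) ^ 4 * ((1 + 1 / real s) ^ (4 * (s - Suc k)) / (300 * real s ^ 4))"
        using Suc.prems(5) s by (intro mult_left_mono) auto
      also have "\<dots> = (1 + 1 / real s) ^ (4 + 4 * (s - Suc k)) / (300 * real s ^ 4)"
        by (simp add: power_add)
      also have "4 + 4 * (s - Suc k) = 4 * (s - k)" using Suc.prems(2) by simp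
      finally show "coverable P {I. I \<subseteq> V \<and> avoids z I} ((k - 1) * m)"
        using Suc.IH k Suc.prems(2) z by simp
    qed
    moreover have "(k - 1) * m + m = (Suc k - 1) * m" using k by (cases k) auto
    ultimately show ?thesis by simp
  qed
qed

end

section \<open>The container theorem\<close>

context uniform_hypergraph begin

definition edge_weight :: "'a set \<Rightarrow> real" where
  "edge_weight e = real (count E e) / real (size E)"

lemma avoids_edge_weight:
  assumes "E \<noteq> {#}"
  shows "{I. I \<subseteq> V \<and> avoids edge_weight I} = independent_sets V E"
  using assms unfolding avoids_def edge_weight_def independent_sets_def
  by (auto simp: count_eq_zero_iff)

text \<open>
  The constant \<open>deg\<close> depends on \<open>V\<close> alone; the number \<open>B\<close> only serves to instantiate the locale.
\<close>

lemma deg_edge_weight: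
  fixes B :: real
  assumes "0 < B"
  shows "weighted_ground.deg V edge_weight T = real (hdegree E T) / real (size E)"
proof -
  interpret weighted_ground V B using finite_vertices assms by unfold_locales
  have "hdegree E T = (\<Sum>e\<in>{e \<in> set_mset E. T \<subseteq> e}. count E e)"
    unfolding hdegree_def size_multiset_overloaded_eq by (intro sum.cong) auto
  also have "\<dots> = (\<Sum>e\<in>{e \<in> Pow V. T \<subseteq> e}. count E e)"
    using finite_vertices edge_subset
    by (intro sum.mono_neutral_left) (auto simp: count_eq_zero_iff)
  finally have "real (hdegree E T) = (\<Sum>e\<in>{e \<in> Pow V. T \<subseteq> e}. real (count E e))" by simp
  then show ?thesis
    unfolding deg_def edge_weight_def using finite_vertices
    by (simp add: sum.If_cases Int_def sum_divide_distrib)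
qed

lemma energy_edge_weight:
  fixes B :: real
  assumes "1 \<le> s" and "0 < B"
  shows "weighted_ground.pairing V B s edge_weight edge_weight
    = (\<Sum>t = 1..s. real ((s - 1) choose (t - 1)) * B ^ (t - 1) * (degree_measure_norm s V E t)\<^sup>2)"
proof -
  interpret weighted_ground V B using finite_vertices assms(2) by unfold_locales
  define h where "h T = coeff s (card T) * (deg edge_weight T * deg edge_weight T)" for T
  define X where "X = {T \<in> Pow V. card T \<in> {1..s}}"
  have "energy s edge_weight = (\<Sum>T\<in>X. h T)"
    unfolding pairing_def h_def[symmetric] X_def
  proof (rule sum.mono_neutral_right)
    show "\<forall>T\<in>Pow V - {T \<in> Pow V. card T \<in> {1..s}}. h T = 0"
      unfolding h_def coeff_def by (auto simp: not_le)
  qed (use finite_vertices in auto)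
  also have "\<dots> = (\<Sum>t = 1..s. \<Sum>T\<in>{T \<in> X. card T = t}. h T)"
    using finite_vertices unfolding X_def by (intro sum.group[symmetric]) auto
  also have "\<dots> = (\<Sum>t = 1..s. real ((s - 1) choose (t - 1)) * B ^ (t - 1) * (degree_measure_norm s V E t)\<^sup>2)"
  proof (rule sum.cong[OF refl])
    fix t assume t: "t \<in> {1..s}"
    have "t * (s choose t) = s * ((s - 1) choose (t - 1))"
      using t by (intro times_binomial_minus1_eq) auto
    then have bin: "real t * real (s choose t) = real s * real ((s - 1) choose (t - 1))"
      by (metis of_nat_mult)
    have pos: "0 < real (s choose t)" "0 < real s" using t by auto
    have c: "coeff s t = real ((s - 1) choose (t - 1)) * B ^ (t - 1) / (real (s choose t))\<^sup>2"
      unfolding coeff_def using bin pos by (simp add: divide_simps power2_eq_square)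
    have "{T \<in> X. card T = t} = {T. T \<subseteq> V \<and> card T = t}" using t unfolding X_def by auto
    moreover have "h T = real ((s - 1) choose (t - 1)) * B ^ (t - 1) * (degree_measure s E t T)\<^sup>2"
      if "card T = t" for T
      unfolding h_def that c deg_edge_weight[OF assms(2)] degree_measure_def
      by (simp add: power2_eq_square)
    ultimately show "(\<Sum>T\<in>{T \<in> X. card T = t}. h T)
        = real ((s - 1) choose (t - 1)) * B ^ (t - 1) * (degree_measure_norm s V E t)\<^sup>2"
      unfolding degree_measure_norm_def L2_set_def
      by (simp add: sum_nonneg sum_distrib_left)
  qed
  finally show ?thesis .
qed

end

theorem theorem2p1:
  fixes s :: nat and V :: "'a set" and E :: "'a set multiset" and p \<delta> :: real
  assumes "s \<ge> 1"
    and "uniform_hypergraph s V E"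
    and "E \<noteq> {#}"
    and "0 < p" and "p < 1"
    and "0 < \<delta>" and "\<delta> < 1"
    and "300 * real s ^ 4 * (\<Sum>t = 1..s. real ((s - 1) choose (t - 1)) *
           (5000 * real s ^ 3 / p) ^ (t - 1) * (degree_measure_norm s V E t)\<^sup>2)
         \<le> 1 / (\<delta> * real (card V))"
    and "1 / (\<delta> * real (card V)) \<le> p / 500"
  shows "\<exists>(S :: 'a set set) (f :: 'a set \<Rightarrow> 'a set) (g :: 'a set \<Rightarrow> 'a set).
           (\<forall>A \<in> S. A \<subseteq> V \<and> real (card A) \<le> 30 * real s ^ 2 * p * real (card V)) \<and>
           f \<in> S \<rightarrow> Pow V \<and>
           g \<in> independent_sets V E \<rightarrow> S \<and>
           (\<forall>I \<in> independent_sets V E.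
              g I \<subseteq> I \<and> I \<subseteq> g I \<union> f (g I) \<and>
              real (card (f (g I))) \<le> (1 - \<delta>) * real (card V)) \<and>
           (\<forall>I \<in> independent_sets V E. \<forall>I' \<in> independent_sets V E.
              g I \<subseteq> I' \<and> g I' \<subseteq> I \<longrightarrow> g I = g I')"
proof -
  define B where "B = 5000 * real s ^ 3 / p"
  have s: "1 \<le> real s" using assms(1) by simp
  have B: "0 < B" unfolding B_def using s assms(4) by simp
  interpret uniform_hypergraph s V E by fact
  interpret weighted_ground V B using finite_vertices B by unfold_locales
  define n where "n = real (card V)"
  obtain e where e: "e \<in># E" using assms(3) by (meson multiset_nonemptyE)
  have "V \<noteq> {}" using edge_subset[OF e] card_edge[OF e] assms(1) by auto
  then have card_pos: "0 < card V" using finite_vertices by (simp add: card_gt_0_iff)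
  then have n: "0 < n" unfolding n_def by simp
  have "1 \<le> p * n"
  proof -
    have "500 \<le> p * (\<delta> * n)"
      using assms(9) n assms(6) unfolding n_def[symmetric] by (simp add: field_simps)
    also have "\<dots> \<le> p * (1 * n)"
      using assms(4,7) n by (intro mult_left_mono mult_right_mono) auto
    finally show ?thesis by simp
  qed
  \<comment> \<open>The number of positive answers in each of the \<open>s - 1\<close> rounds.\<close>
  define m where "m = nat \<lceil>p * n\<rceil>"
  have m: "p * n \<le> real m" "real m \<le> 2 * (p * n)" "0 < m"
    using \<open>1 \<le> p * n\<close> unfolding m_def by linarith+
  define P where "P C \<longleftrightarrow> C \<subseteq> V \<and> real (card C) \<le> (1 - \<delta>) * n" for C
  have "coverable P {I. I \<subseteq> V \<and> avoids edge_weight I} ((s - 1) * m)"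
  proof (rule coverable_independent[where P = P, OF card_pos m(3) assms(6)])
    fix k :: nat assume "1 \<le> k"
    have "4 * real s * n / (real (Suc k) * B) \<le> 4 * real s * n / (2 * B)"
      using \<open>1 \<le> k\<close> B s n by (intro divide_left_mono mult_right_mono) auto
    also have "\<dots> = p * n / (2500 * (real s)\<^sup>2)"
      unfolding B_def using s assms(4) by (simp add: field_simps power2_eq_square power3_eq_cube)
    also have "\<dots> \<le> real m / (2 * (real s)\<^sup>2)"
      using m s by (intro frac_le) auto
    finally show "4 * real s * real (card V) / (real (Suc k) * B) \<le> real m / (2 * (real s)\<^sup>2)"
      unfolding n_def .
  next
    fix N assume "N \<subseteq> V" "\<delta> * real (card V) \<le> real (card N)"
    moreover from this have "card N \<le> card V" "card (V - N) = card V - card N"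
      using finite_vertices by (auto simp: card_mono card_Diff_subset finite_subset)
    ultimately show "P (V - N)"
      unfolding P_def n_def by (auto simp: of_nat_diff algebra_simps)
  next
    show "uniform_weight s edge_weight"
      unfolding uniform_weight_def edge_weight_def
      using edge_subset card_edge by (auto simp: count_eq_zero_iff)
    have "{#e \<in># E. {} \<subseteq> e#} = E" by (rule multiset_eqI) simp
    then have "hdegree E {} = size E" unfolding hdegree_def by (rule arg_cong)
    then show "deg edge_weight {} = 1"
      unfolding deg_edge_weight[OF B] using assms(3) by simp
    have "300 * real s ^ 4 * energy s edge_weight \<le> 1 / (\<delta> * n)"
      using assms(8) unfolding energy_edge_weight[OF assms(1) B] n_def unfolding B_def .
    then show "\<delta> * real (card V) * energy s edge_weight
        \<le> (1 + 1 / real s) ^ (4 * (s - s)) / (300 * real s ^ 4)"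
      using n assms(6) s unfolding n_def[symmetric] by (simp add: field_simps)
  qed (use assms(1) in auto)
  then obtain t where t: "\<And>I. I \<in> independent_sets V E \<Longrightarrow>
      I \<subseteq> container t I \<and> P (container t I) \<and> card (fingerprint t I) \<le> (s - 1) * m"
    unfolding coverable_def avoids_edge_weight[OF assms(3)] by blast
  have budget: "real ((s - 1) * m) \<le> 30 * real s ^ 2 * p * n"
  proof -
    have "real ((s - 1) * m) \<le> real s * (2 * (p * n))"
      using m assms(1) by (auto intro!: mult_mono simp: of_nat_diff)
    also have "\<dots> \<le> (30 * real s ^ 2) * (p * n)"
    proof -
      have "real s * 2 \<le> 30 * real s ^ 2" using mult_right_mono[OF s, of "real s"] s by (simp add: power2_eq_square)
      then show ?thesis using mult_right_mono[of "real s * 2" "30 * real s ^ 2" "p * n"] \<open>1 \<le> p * n\<close> by simp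
    qed
    finally show ?thesis by (simp add: mult.assoc)
  qed
  have rerun: "container t (fingerprint t I) = container t I" for I
    using same_run[of t "fingerprint t I" I] fingerprint_subset[of t] by (meson order_refl order_trans)
  show ?thesis
  proof (intro exI conjI)
    show "\<forall>A\<in>fingerprint t ` independent_sets V E.
        A \<subseteq> V \<and> real (card A) \<le> 30 * real s ^ 2 * p * real (card V)"
    proof (intro ballI, elim imageE)
      fix A I assume I: "I \<in> independent_sets V E" and A: "A = fingerprint t I"
      have "real (card A) \<le> real ((s - 1) * m)" using t[OF I] A by (simp only: of_nat_le_iff)
      moreover have "A \<subseteq> V"
        using I fingerprint_subset[of t I] unfolding A independent_sets_def by auto
      ultimately show "A \<subseteq> V \<and> real (card A) \<le> 30 * real s ^ 2 * p * real (card V)"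
        using budget unfolding n_def by simp
    qed
    show "container t \<in> fingerprint t ` independent_sets V E \<rightarrow> Pow V"
    proof
      fix A assume "A \<in> fingerprint t ` independent_sets V E"
      then obtain I where "I \<in> independent_sets V E" and A: "A = fingerprint t I" by blast
      then show "container t A \<in> Pow V" using t unfolding A rerun P_def by blast
    qed
    show "fingerprint t \<in> independent_sets V E \<rightarrow> fingerprint t ` independent_sets V E" by auto
    show "\<forall>I\<in>independent_sets V E. fingerprint t I \<subseteq> I \<and>
        I \<subseteq> fingerprint t I \<union> container t (fingerprint t I) \<and>
        real (card (container t (fingerprint t I))) \<le> (1 - \<delta>) * real (card V)"
    proof
      fix I assume I: "I \<in> independent_sets V E"
      show "fingerprint t I \<subseteq> I \<and> I \<subseteq> fingerprint t I \<union> container t (fingerprint t I) \<and>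
          real (card (container t (fingerprint t I))) \<le> (1 - \<delta>) * real (card V)"
        using t[OF I] fingerprint_subset[of t I] unfolding rerun P_def n_def by auto
    qed
    show "\<forall>I\<in>independent_sets V E. \<forall>I'\<in>independent_sets V E.
        fingerprint t I \<subseteq> I' \<and> fingerprint t I' \<subseteq> I \<longrightarrow> fingerprint t I = fingerprint t I'"
      using same_run by blast
  qed
qed

end
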